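(* Let $\mathbb{X}=\mathbb{Y}$ be a Hilbert space with scalar product $\langle\cdot,\cdot\rangle$. Let $\mathbb{W}$ be a set. Let $h:\mathbb{W}\to\overline{\mathbb{R}}$ be a function, $W\subset\mathbb{W}$ be a nonempty set and $\theta:W\to\mathbb{X}$ be a mapping. If 1. the set $-\theta(W)$ is weakly bounded, that is, the barrier cone of $-\theta(W)$ is the full space, namely $\mathrm{bar}(-\theta(W))=\mathbb{Y}$, 2. the convex lower semicontinuous function $(\theta\rhd h)^{\star}:\mathbb{Y}\to\overline{\mathbb{R}}$ is proper, then the lower bound $\sup_{y\in\mathbb{Y}}\big((-(\theta\rhd h)^{\star}(y))\,\underset{\cdot}{+}\,(-\sigma_{-\theta(W)}(y))\big)$ of $\inf_{w\in W}h(w)$ has the following alternative primal expression: $$\sup_{y\in\mathbb{Y}}\Big(\big(-(\theta\rhd h)^{\star}(y)\big)\,\underset{\cdot}{+}\,\big(-\sigma_{-\theta(W)}(y)\big)\Big)=\min_{x\in\overline{\mathrm{co}}(-\theta(W))}(\theta\rhd h)^{\star\star'}(x)\;\le\;\inf_{w\in W}h(w),$$ where the primal problem (the minimization over $x$) consists in the minimization of a lower semicontinuous convex function on a weakly bounded and closed convex set.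
   Context: $\overline{\mathbb{R}}=[-\infty,+\infty]$. The Moreau lower addition $\underset{\cdot}{+}$ on $\overline{\mathbb{R}}$ extends the usual addition with $(+\infty)\underset{\cdot}{+}(-\infty)=(-\infty)\underset{\cdot}{+}(+\infty)=-\infty$. Infimal postcomposition: $\theta\rhd h:\mathbb{X}\to\overline{\mathbb{R}}$ is defined by $(\theta\rhd h)(x)=\inf\{h(w): w\in\mathbb{W},\ \theta(w)=x\}$, with the convention $\inf\emptyset=+\infty$; only points $w$ at which $\theta$ is defined (here $w\in W$) enter the infimum. Fenchel conjugate of $f:\mathbb{X}\to\overline{\mathbb{R}}$: $f^{\star}(y)=\sup_{x\in\mathbb{X}}\big(\langle x,y\rangle\underset{\cdot}{+}(-f(x))\big)$ for $y\in\mathbb{Y}$; biconjugate: $f^{\star\star'}(x)=\sup_{y\in\mathbb{Y}}\big(\langle x,y\rangle\underset{\cdot}{+}(-f^{\star}(y))\big)$ for $x\in\mathbb{X}$. A function with values in $\overline{\mathbb{R}}$ is proper if it never takes the value $-\infty$ and is not identically $+\infty$. For $X\subset\mathbb{X}$: the support function is $\sigma_X(y)=\sup_{x\in X}\langle x,y\rangle$; the barrier cone is $\mathrm{bar}(X)=\{y\in\mathbb{Y}:\sigma_X(y)<+\infty\}$; $X$ is weakly bounded if $\sup_{x\in X}\langle x,y\rangle<+\infty$ for all $y\in\mathbb{Y}$; $\overline{\mathrm{co}}(X)$ is the closed convex hull of $X$, and $-X=\{-x:x\in X\}$.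
   Formalization: The minimum is taken over the closed convex hull of θ(W) instead of −θ(W); with the printed sign the claim is false, e.g. for X=ℝ, W={w}, θ(w)=1, h(w)=0, where the supremum is 0 but the minimum is +∞. *)

theory Defs
  imports "HOL-Analysis.Analysis"
begin

text \<open>
  The library addition on \<^typ>\<open>ereal\<close> is the upper one
  (\<^prop>\<open>(\<infinity>::ereal) + (-\<infinity>) = \<infinity>\<close>), so the Moreau lower addition is defined separately.
\<close>

definition lower_add :: "ereal \<Rightarrow> ereal \<Rightarrow> ereal"  (infixl "+\<^sub>l" 65)
  where "a +\<^sub>l b = (if a = -\<infinity> \<or> b = -\<infinity> then -\<infinity> else a + b)"

lemma lower_add_infty [simp]:
  "\<infinity> +\<^sub>l (-\<infinity>) = -\<infinity>" "(-\<infinity>) +\<^sub>l \<infinity> = -\<infinity>"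
  by (simp_all add: lower_add_def)

text \<open>
  The set \<open>W\<close> is the domain of the partial map \<open>\<theta>\<close>; values of \<open>\<theta>\<close> outside \<open>W\<close> are
  irrelevant.  The infimum over the empty set is \<open>\<infinity>\<close> on \<^typ>\<open>ereal\<close>.
\<close>

definition inf_postcomp :: "'w set \<Rightarrow> ('w \<Rightarrow> 'a) \<Rightarrow> ('w \<Rightarrow> ereal) \<Rightarrow> 'a \<Rightarrow> ereal"
  where "inf_postcomp W \<theta> h x = (INF w\<in>{w \<in> W. \<theta> w = x}. h w)"

definition conjugate :: "('a::real_inner \<Rightarrow> ereal) \<Rightarrow> 'a \<Rightarrow> ereal"
  where "conjugate f y = (SUP x. ereal (x \<bullet> y) +\<^sub>l (- f x))"

definition biconjugate :: "('a::real_inner \<Rightarrow> ereal) \<Rightarrow> 'a \<Rightarrow> ereal"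
  where "biconjugate f x = (SUP y. ereal (x \<bullet> y) +\<^sub>l (- conjugate f y))"

definition proper_fun :: "('a \<Rightarrow> ereal) \<Rightarrow> bool"
  where "proper_fun f \<longleftrightarrow> (\<forall>x. f x \<noteq> -\<infinity>) \<and> (\<exists>x. f x \<noteq> \<infinity>)"

text \<open>Convexity of extended-real-valued functions is convexity of the epigraph.\<close>

definition convex_fun :: "('a::real_vector \<Rightarrow> ereal) \<Rightarrow> bool"
  where "convex_fun f \<longleftrightarrow> convex {(x, r::real). f x \<le> ereal r}"

definition lower_semicontinuous :: "('a::topological_space \<Rightarrow> ereal) \<Rightarrow> bool"
  where "lower_semicontinuous f \<longleftrightarrow> (\<forall>x c. c < f x \<longrightarrow> (\<forall>\<^sub>F z in nhds x. c < f z))"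

lemma biconjugate_eq_conjugate: "biconjugate f = conjugate (conjugate f)"
  by (simp add: fun_eq_iff biconjugate_def conjugate_def inner_commute)

text \<open>
  Conjugates are convex and lower semicontinuous whatever the function, so these two
  properties never need to be assumed of a conjugate.
\<close>

lemma conjugate_le_iff:
  "conjugate f y \<le> ereal c \<longleftrightarrow> (\<forall>x. ereal (x \<bullet> y) +\<^sub>l (- f x) \<le> ereal c)"
  by (simp add: conjugate_def SUP_le_iff)

lemma convex_fun_conjugate: "convex_fun (conjugate f)"
proof -
  have "{(y, r::real). conjugate f y \<le> ereal r}
      = (\<Inter>x. {(y, r). ereal (x \<bullet> y) +\<^sub>l (- f x) \<le> ereal r})"
    by (auto simp: conjugate_le_iff)
  moreover have "convex {(y, r::real). ereal (x \<bullet> y) +\<^sub>l (- f x) \<le> ereal r}" for x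
  proof (cases "f x")
    case (real a)
    have "{(y, r::real). ereal (x \<bullet> y) +\<^sub>l (- f x) \<le> ereal r}
        = {p. (x, - 1) \<bullet> p \<le> a}"
      by (auto simp: real lower_add_def)
    then show ?thesis by (simp add: convex_halfspace_le)
  qed (auto simp: lower_add_def)
  ultimately show ?thesis
    unfolding convex_fun_def by (metis (no_types, lifting) convex_INT)
qed

lemma lower_semicontinuous_conjugate: "lower_semicontinuous (conjugate f)"
  unfolding lower_semicontinuous_def
proof (intro allI impI)
  fix y c assume "c < conjugate f y"
  then obtain x where x: "c < ereal (x \<bullet> y) +\<^sub>l (- f x)"
    by (auto simp: conjugate_def less_SUP_iff)
  have "\<forall>\<^sub>F z in nhds y. c < ereal (x \<bullet> z) +\<^sub>l (- f x)"
  proof (cases "f x")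
    case (real a)
    have lim: "((\<lambda>z. ereal (x \<bullet> z - a)) \<longlongrightarrow> ereal (x \<bullet> y - a)) (nhds y)"
      by (intro tendsto_intros filterlim_ident)
    then show ?thesis
      using x order_tendstoD(1)[OF lim, of c] by (simp add: real lower_add_def)
  qed (use x in \<open>auto simp: lower_add_def\<close>)
  then show "\<forall>\<^sub>F z in nhds y. c < conjugate f z"
    by (rule eventually_mono) (auto simp: conjugate_def less_SUP_iff)
qed

definition support_fun :: "'a::real_inner set \<Rightarrow> 'a \<Rightarrow> ereal"
  where "support_fun X y = (SUP x\<in>X. ereal (x \<bullet> y))"

definition barrier_cone :: "'a::real_inner set \<Rightarrow> 'a set"
  where "barrier_cone X = {y. support_fun X y < \<infinity>}"

definition weakly_bounded :: "'a::real_inner set \<Rightarrow> bool"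
  where "weakly_bounded X \<longleftrightarrow> (\<forall>y. (SUP x\<in>X. ereal (x \<bullet> y)) < \<infinity>)"

lemma weakly_bounded_iff_barrier_cone: "weakly_bounded X \<longleftrightarrow> barrier_cone X = UNIV"
  by (auto simp: weakly_bounded_def barrier_cone_def support_fun_def)

abbreviation closed_convex_hull :: "'a::real_normed_vector set \<Rightarrow> 'a set"
  where "closed_convex_hull X \<equiv> closure (convex hull X)"

text \<open>
  Sign convention: a dual term \<open>- support_fun (uminus ` X) y\<close> equals
  \<open>INF x\<in>X. ereal (x \<bullet> y)\<close>, so the primal feasible set that it dualizes is
  the closed convex hull of \<open>X\<close> and not of \<open>uminus ` X\<close>.  With the latter, duality fails
  already on the real line, for \<open>W = {w}\<close>, \<open>\<theta> w = 1\<close> and \<open>h w = 0\<close>:  the dual value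
  is \<open>0\<close>, while the biconjugate is \<open>\<infinity>\<close> at \<open>-1\<close>.
\<close>

end

theory Submission
  imports Defs
begin

text \<open>
  For \<open>F\<close> convex, \<open>K = closed_convex_hull X\<close> and \<open>v\<close> the dual value, one needs a point
  \<open>x \<in> K\<close> with \<open>x \<bullet> y - r \<le> c\<close> for all \<open>(y, r)\<close> in the epigraph of \<open>F\<close> and all \<open>c > v\<close>.
  By definition of \<open>v\<close> each single strict inequality has a solution in \<open>K\<close>.  Separation in
  the plane handles two inequalities at once, since convex combinations of points of
  the epigraph stay in it, and induction, each time shrinking \<open>K\<close> to a sublevel set,
  handles finitely many.  By the Baire category theorem \<open>K\<close> is norm bounded, and
  bounded closed convex subsets of a Hilbert space have the finite intersection property.
\<close>

section \<open>Minimax for finitely many convex functions\<close>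

lemma convex_sublevel_set:
  assumes "convex_on S f"
  shows "convex {x \<in> S. f x \<le> c}" and "convex {x \<in> S. f x < c}"
proof -
  have *: "u *\<^sub>R x + v *\<^sub>R y \<in> S \<and> f (u *\<^sub>R x + v *\<^sub>R y) \<le> u * f x + v * f y"
    if "x \<in> S" "y \<in> S" "u \<ge> 0" "v \<ge> 0" "u + v = 1" for x y u v
    using assms that by (auto simp: convex_on_def intro: convexD)
  show "convex {x \<in> S. f x \<le> c}"
  proof (rule convexI)
    fix x y and u v :: real
    assume "x \<in> {x \<in> S. f x \<le> c}" "y \<in> {x \<in> S. f x \<le> c}" "0 \<le> u" "0 \<le> v" "u + v = 1"
    then show "u *\<^sub>R x + v *\<^sub>R y \<in> {x \<in> S. f x \<le> c}"
      using *[of x y u v] convex_bound_le[of "f x" c "f y" u v] by simp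
  qed
  show "convex {x \<in> S. f x < c}"
  proof (rule convexI)
    fix x y and u v :: real
    assume "x \<in> {x \<in> S. f x < c}" "y \<in> {x \<in> S. f x < c}" "0 \<le> u" "0 \<le> v" "u + v = 1"
    then show "u *\<^sub>R x + v *\<^sub>R y \<in> {x \<in> S. f x < c}"
      using *[of x y u v] convex_bound_lt[of "f x" c "f y" u v] by simp
  qed
qed

text \<open>Otherwise \<open>(c, c)\<close> lies outside the convex set \<open>M\<close> of pairs
  strictly above some \<open>(f x, g x)\<close>. A separating normal \<open>(r, s)\<close> has
  nonnegative entries because \<open>M\<close> is stable under raising coordinates. Divided by
  \<open>r + s\<close>, it gives a convex combination that is at least \<open>c\<close> on all of
  \<open>K\<close>, against \<open>comb\<close>.\<close>

lemma ex_lt_two_of_ex_lt_convex_comb: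
  fixes f g :: "'a::real_vector \<Rightarrow> real"
  assumes f: "convex_on K f" and g: "convex_on K g"
    and comb: "\<And>u v. u \<ge> 0 \<Longrightarrow> v \<ge> 0 \<Longrightarrow> u + v = 1 \<Longrightarrow> \<exists>x\<in>K. u * f x + v * g x < c"
  shows "\<exists>x\<in>K. f x < c \<and> g x < c"
proof (rule ccontr)
  assume neg: "\<not> ?thesis"
  define M where "M = {(a, b). \<exists>x\<in>K. f x < a \<and> g x < b}"
  have memM: "(a, b) \<in> M \<longleftrightarrow> (\<exists>x\<in>K. f x < a \<and> g x < b)" for a b
    by (simp add: M_def)
  obtain x0 where x0: "x0 \<in> K" using comb[of 1 0] by auto
  have "convex M"
    unfolding convex_alt
  proof (intro ballI allI impI)
    fix p q and t :: real
    assume "p \<in> M" "q \<in> M" and t: "0 \<le> t \<and> t \<le> 1"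
    then obtain x y where x: "x \<in> K" "f x < fst p" "g x < snd p"
      and y: "y \<in> K" "f y < fst q" "g y < snd q"
      by (auto simp: M_def)
    let ?z = "(1 - t) *\<^sub>R x + t *\<^sub>R y"
    have "?z \<in> K"
      using f x y t by (simp add: convex_on_def convex_alt)
    moreover have strict: "(1 - t) * a + t * b < (1 - t) * a' + t * b'"
      if "a < a'" "b < b'" for a b a' b' :: real
      using that t by (cases "t = 0")
        (auto intro!: add_le_less_mono mult_left_mono mult_strict_left_mono)
    have "f ?z < (1 - t) * fst p + t * fst q"
      using convex_onD[OF f, of t x y] x y t strict[OF x(2) y(2)] by simp
    moreover have "g ?z < (1 - t) * snd p + t * snd q"
      using convex_onD[OF g, of t x y] x y t strict[OF x(3) y(3)] by simp
    ultimately show "(1 - t) *\<^sub>R p + t *\<^sub>R q \<in> M"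
      by (auto simp: M_def split_beta)
  qed
  moreover have "(f x0 + 1, g x0 + 1) \<in> M"
    unfolding memM using x0 by (intro bexI[of _ x0]) auto
  moreover have "(c, c) \<notin> M"
    using neg by (simp add: memM)
  \<comment> \<open>\<open>M\<close> lives in the plane whatever the dimension of the domain, so
    separation of disjoint nonempty convex sets in finite dimension applies.\<close>
  ultimately obtain p b where p: "p \<noteq> 0" and pc: "p \<bullet> (c, c) \<le> b"
    and pM: "\<And>m. m \<in> M \<Longrightarrow> b \<le> p \<bullet> m"
    using separating_hyperplane_sets[of "{(c, c)}" M] by force
  obtain r s where rs: "p = (r, s)" by (cases p)
  have le: "r * c + s * c \<le> r * a1 + s * a2" if "x \<in> K" "f x < a1" "g x < a2" for x a1 a2
  proof -
    have "(a1, a2) \<in> M" using that by (auto simp: memM)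
    from order_trans[OF pc pM[OF this]] show ?thesis by (simp add: rs)
  qed
  have "r \<ge> 0"
  proof (rule ccontr)
    assume "\<not> r \<ge> 0"
    \<comment> \<open>Were \<open>r\<close> negative, raising the first coordinate by
      \<open>d / - r\<close> would stay in \<open>M\<close> and lower the functional by
      \<open>d\<close>, which exceeds its gap to the value at \<open>(c, c)\<close>. The argument
      for \<open>s\<close> is the same.\<close>
    define d where "d = \<bar>r * c + s * c - r * (f x0 + 1) - s * (g x0 + 1)\<bar> + 1"
    have "d > 0" by (simp add: d_def)
    have "r * c + s * c \<le> r * (f x0 + 1 + d / - r) + s * (g x0 + 1)"
      using \<open>d > 0\<close> \<open>\<not> r \<ge> 0\<close> divide_pos_pos[of d "-r"] by (intro le[OF x0]) linarith+
    also have "\<dots> = r * (f x0 + 1) + s * (g x0 + 1) - d"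
      using \<open>\<not> r \<ge> 0\<close> by (simp add: field_simps)
    finally show False unfolding d_def by linarith
  qed
  moreover have "s \<ge> 0"
  proof (rule ccontr)
    assume "\<not> s \<ge> 0"
    define d where "d = \<bar>r * c + s * c - r * (f x0 + 1) - s * (g x0 + 1)\<bar> + 1"
    have "d > 0" by (simp add: d_def)
    have "r * c + s * c \<le> r * (f x0 + 1) + s * (g x0 + 1 + d / - s)"
      using \<open>d > 0\<close> \<open>\<not> s \<ge> 0\<close> divide_pos_pos[of d "-s"] by (intro le[OF x0]) linarith+
    also have "\<dots> = r * (f x0 + 1) + s * (g x0 + 1) - d"
      using \<open>\<not> s \<ge> 0\<close> by (simp add: field_simps)
    finally show False unfolding d_def by linarith
  qed
  ultimately have pos: "r + s > 0" and "r \<ge> 0" "s \<ge> 0"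
    using p rs by (auto simp: zero_prod_def)
  then obtain x where x: "x \<in> K" and "r / (r + s) * f x + s / (r + s) * g x < c"
    using comb[of "r / (r + s)" "s / (r + s)"] by (auto simp: add_divide_distrib[symmetric])
  then have lt: "r * f x + s * g x < (r + s) * c"
    using pos by (simp add: pos_divide_less_eq mult.commute flip: add_divide_distrib)
  \<comment> \<open>\<open>t\<close> is the slack at \<open>x\<close>. Raising both values by
    \<open>d\<close> gives a point of \<open>M\<close> and uses up only half of it.\<close>
  define t where "t = r * c + s * c - (r * f x + s * g x)"
  have "t > 0" using lt by (simp add: t_def distrib_right)
  define d where "d = t / 2 / (r + s)"
  have "d > 0" using \<open>t > 0\<close> pos by (simp add: d_def)
  then have "r * c + s * c \<le> r * (f x + d) + s * (g x + d)"
    by (intro le[OF x]) auto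
  also have "\<dots> = r * f x + s * g x + (r + s) * d"
    by (simp add: algebra_simps)
  also have "(r + s) * d = t / 2"
    using pos unfolding d_def by (metis less_irrefl nonzero_eq_divide_eq mult.commute)
  finally show False
    using \<open>t > 0\<close> t_def by linarith
qed

text \<open>The induction runs over \<open>K\<close> as well: after passing to the sublevel set
  \<open>K'\<close> of one function, the two-function lemma restores strict solvability on
  \<open>K'\<close> for every index in \<open>E\<close>. Convexity of \<open>E\<close> and concavity
  in the index turn a convex combination of two functions into a lower bound for a third one of the
  family.\<close>

lemma finite_minimax:
  fixes f :: "'b::real_vector \<Rightarrow> 'a::real_vector \<Rightarrow> real"
  assumes fin: "finite A" and "A \<subseteq> E" and E: "convex E"
    and "convex K" "K \<noteq> {}"
    and "\<And>e. e \<in> E \<Longrightarrow> convex_on K (f e)"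
    and conc: "\<And>x. x \<in> K \<Longrightarrow> concave_on E (\<lambda>e. f e x)"
    and "\<And>e. e \<in> E \<Longrightarrow> \<exists>x\<in>K. f e x < c"
  shows "\<exists>x\<in>K. \<forall>e\<in>A. f e x < c"
  using fin assms(2,4-)
proof (induction A arbitrary: K rule: finite_induct)
  case empty
  then show ?case by auto
next
  case (insert e A)
  define K' where "K' = {x \<in> K. f e x < c}"
  have e: "e \<in> E" and K: "convex K" using insert.prems by auto
  have sub: "K' \<subseteq> K" by (auto simp: K'_def)
  have K': "convex K'"
    unfolding K'_def using insert.prems(4)[OF e] by (rule convex_sublevel_set)
  have two: "\<exists>x\<in>K'. f e' x < c" if e': "e' \<in> E" for e'
  proof -
    have "\<exists>x\<in>K. f e x < c \<and> f e' x < c"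
    proof (rule ex_lt_two_of_ex_lt_convex_comb)
      fix u v :: real assume uv: "u \<ge> 0" "v \<ge> 0" "u + v = 1"
      then have "u *\<^sub>R e + v *\<^sub>R e' \<in> E"
        using E e e' by (simp add: convex_def)
      then obtain x where x: "x \<in> K" "f (u *\<^sub>R e + v *\<^sub>R e') x < c"
        using insert.prems(6) by blast
      moreover have "u * f e x + v * f e' x \<le> f (u *\<^sub>R e + v *\<^sub>R e') x"
        using insert.prems(5)[OF x(1)] e e' uv by (auto simp: concave_on_iff)
      ultimately show "\<exists>x\<in>K. u * f e x + v * f e' x < c" by force
    qed (use insert.prems(4) e e' in blast)+
    then show ?thesis by (auto simp: K'_def)
  qed
  have "\<exists>x\<in>K'. \<forall>e\<in>A. f e x < c"
    using insert.prems(1,4,5) sub K' two two[OF e]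
    by (intro insert.IH) (auto intro: convex_on_subset)
  then show ?case by (auto simp: K'_def)
qed

section \<open>Intersections of bounded closed convex sets, and minimax for infinite
  families\<close>

text \<open>
  Near-minimizers of the norm over the finite intersections form a Cauchy family, by the
  parallelogram law; this replaces weak compactness.
\<close>

lemma bounded_closed_convex_fip:
  fixes \<C> :: "'a::{real_inner, complete_space} set set"
  assumes K: "K \<in> \<C>" "bounded K"
    and closed: "\<And>S. S \<in> \<C> \<Longrightarrow> closed S" and convex: "\<And>S. S \<in> \<C> \<Longrightarrow> convex S"
    and fip: "\<And>\<F>. finite \<F> \<Longrightarrow> \<F> \<subseteq> \<C> \<Longrightarrow> K \<in> \<F> \<Longrightarrow> \<Inter>\<F> \<noteq> {}"
  shows "\<Inter>\<C> \<noteq> {}"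
proof -
  \<comment> \<open>Every family in \<open>\<A>\<close> contains \<open>K\<close>, so its
    intersection lies in the ball of radius \<open>B\<close>. Hence the squared distances
    \<open>q\<close> from the origin are bounded above and the supremum \<open>D\<close> is
    finite.\<close>
  define \<A> where "\<A> = {\<F>. finite \<F> \<and> \<F> \<subseteq> \<C> \<and> K \<in> \<F>}"
  define q where "q \<F> = (INF x\<in>\<Inter>\<F>. (norm x)\<^sup>2)" for \<F> :: "'a set set"
  define D where "D = (SUP \<F>\<in>\<A>. q \<F>)"
  obtain B where B: "\<And>x. x \<in> K \<Longrightarrow> norm x \<le> B"
    using K(2) by (auto simp: bounded_iff)
  have bdd_below: "bdd_below ((\<lambda>x. (norm x)\<^sup>2) ` S)" for S :: "'a set"
    by (intro bdd_belowI2[of _ 0]) simp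
  have q_le: "q \<F> \<le> (norm x)\<^sup>2" if "x \<in> \<Inter>\<F>" for \<F> x
    unfolding q_def using that bdd_below by (rule cINF_lower[rotated])
  have ne: "\<Inter>\<F> \<noteq> {}" if "\<F> \<in> \<A>" for \<F>
    using fip that by (simp add: \<A>_def)
  have "{K} \<in> \<A>" using K by (simp add: \<A>_def)
  have bdd: "bdd_above (q ` \<A>)"
  proof (rule bdd_aboveI2)
    fix \<F> assume \<F>: "\<F> \<in> \<A>"
    then obtain x where x: "x \<in> \<Inter>\<F>" using ne by blast
    then have "norm x \<le> B" using \<F> B by (auto simp: \<A>_def)
    then show "q \<F> \<le> B\<^sup>2"
      using q_le[OF x] power_mono[of "norm x" B 2] by simp
  qed
  have q_le_D: "q \<F> \<le> D" if "\<F> \<in> \<A>" for \<F>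
    unfolding D_def using that bdd by (rule cSUP_upper)
  have "\<exists>\<F>\<in>\<A>. D - 1 / Suc n < q \<F>" for n
    using less_cSUP_iff[of \<A> q "D - 1 / Suc n"] \<open>{K} \<in> \<A>\<close> bdd by (auto simp: D_def)
  then obtain F where F: "\<And>n. F n \<in> \<A>" "\<And>n. D - 1 / Suc n < q (F n)"
    by metis
  \<comment> \<open>Cumulative unions make the sets \<open>S n\<close> below decreasing, while
    \<open>q (G n)\<close> stays within \<open>1 / Suc n\<close> of \<open>D\<close>.\<close>
  define G where "G n = (\<Union>k\<le>n. F k)" for n
  have G: "G n \<in> \<A>" for n
    using F(1) by (auto simp: G_def \<A>_def)
  have q_mono: "q \<F> \<le> q \<G>" if "\<F> \<subseteq> \<G>" "\<G> \<in> \<A>" for \<F> \<G>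
    unfolding q_def using that ne[OF that(2)] bdd_below
    by (intro cINF_superset_mono) auto
  have qG: "D - 1 / Suc n < q (G n)" for n
    using F(2)[of n] q_mono[OF _ G, of "F n" n] by (fastforce simp: G_def)
  define S where "S n = \<Inter>(G n) \<inter> {x. (norm x)\<^sup>2 \<le> D + 1 / Suc n}" for n
  have near_min: "\<exists>x\<in>\<Inter>\<F>. (norm x)\<^sup>2 \<le> D + 1 / Suc n" if \<F>: "\<F> \<in> \<A>" for \<F> n
  proof -
    have "q \<F> < D + 1 / Suc n" by (rule le_less_trans[OF q_le_D[OF \<F>]]) simp
    then obtain x where "x \<in> \<Inter>\<F>" "(norm x)\<^sup>2 < D + 1 / Suc n"
      unfolding q_def using cINF_less_iff[OF ne[OF \<F>] bdd_below] by blast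
    then show ?thesis by (auto intro: less_imp_le)
  qed
  \<comment> \<open>The midpoint \<open>m\<close> stays in the convex intersection, so its squared
    norm is at least \<open>D - 1 / Suc n\<close>, while those of \<open>x\<close> and
    \<open>y\<close> are at most \<open>D + 1 / Suc n\<close>. In the parallelogram law
    \<open>D\<close> cancels and \<open>8 / Suc n\<close> remains.\<close>
  have diam: "(dist x y)\<^sup>2 \<le> 8 / Suc n" if xy: "x \<in> S n" "y \<in> S n" for x y n
  proof -
    define m where "m = (1/2) *\<^sub>R x + (1/2) *\<^sub>R y"
    have "convex (\<Inter>(G n))"
      using G[of n] convex by (auto simp: \<A>_def intro!: convex_Inter)
    then have "m \<in> \<Inter>(G n)"
      unfolding m_def using xy by (intro convexD) (auto simp: S_def)
    then have "D - 1 / Suc n \<le> (norm m)\<^sup>2"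
      using qG[of n] q_le[of m "G n"] by simp
    moreover have "(dist x y)\<^sup>2 = 2 * (norm x)\<^sup>2 + 2 * (norm y)\<^sup>2 - 4 * (norm m)\<^sup>2"
      unfolding dist_norm m_def power2_norm_eq_inner
      by (simp add: inner_simps inner_commute field_simps)
    ultimately show ?thesis using xy by (simp add: S_def)
  qed
  have small: "\<exists>n. \<forall>x\<in>S n. \<forall>y\<in>S n. dist x y < \<epsilon>" if "\<epsilon> > 0" for \<epsilon>
  proof -
    obtain n where "inverse (real (Suc n)) < \<epsilon>\<^sup>2 / 8"
      using reals_Archimedean[of "\<epsilon>\<^sup>2 / 8"] \<open>\<epsilon> > 0\<close> by auto
    then have "8 / Suc n < \<epsilon>\<^sup>2" by (simp add: field_simps)
    then have "dist x y < \<epsilon>" if "x \<in> S n" "y \<in> S n" for x y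
      using diam[OF that] \<open>\<epsilon> > 0\<close> by (intro power2_less_imp_less[of _ \<epsilon>]) auto
    then show ?thesis by blast
  qed
  obtain a where a: "\<And>n. a \<in> S n"
  proof (rule decreasing_closed_nest[of S])
    show "closed (S n)" for n
    proof -
      have "closed (\<Inter>(G n))" using G[of n] closed by (auto simp: \<A>_def)
      moreover have "closed {x::'a. (norm x)\<^sup>2 \<le> D + 1 / Suc n}"
        by (intro closed_Collect_le continuous_intros)
      ultimately show ?thesis unfolding S_def by (rule closed_Int)
    qed
    show "S n \<noteq> {}" for n
      using near_min[OF G, of n n] by (auto simp: S_def)
    show "S n \<subseteq> S m" if "m \<le> n" for m n
    proof -
      have "G m \<subseteq> G n" using that by (force simp: G_def)
      moreover have "1 / real (Suc n) \<le> 1 / Suc m" using that by (simp add: field_simps)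
      ultimately show ?thesis by (force simp: S_def)
    qed
  qed (use small in blast)+
  \<comment> \<open>The point \<open>a\<close> comes from the countably many families
    \<open>F n\<close>. Adding an arbitrary \<open>T\<close> to \<open>G n\<close> still leaves a
    near-minimizer, which lies in both \<open>T\<close> and \<open>S n\<close> and is therefore
    close to \<open>a\<close>.\<close>
  have "a \<in> T" if "T \<in> \<C>" for T
  proof -
    have "a \<in> closure T"
      unfolding closure_approachable
    proof (intro allI impI)
      fix \<epsilon> :: real assume "\<epsilon> > 0"
      then obtain n where n: "\<forall>x\<in>S n. \<forall>y\<in>S n. dist x y < \<epsilon>" using small by blast
      have "insert T (G n) \<in> \<A>" using G[of n] that by (simp add: \<A>_def)
      from near_min[OF this, of n] obtain y where "y \<in> T" "y \<in> S n"
        by (auto simp: S_def)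
      then show "\<exists>y\<in>T. dist y a < \<epsilon>" using n a by blast
    qed
    then show ?thesis using closed[OF that] by simp
  qed
  then show ?thesis by blast
qed

text \<open>The closed sublevel sets for all indices and levels, together with \<open>K\<close>,
  have the finite intersection property by \<open>finite_minimax\<close>. A set \<open>C\<close> of
  levels allows them to approach an infimum that is not itself in \<open>C\<close>.\<close>

lemma bounded_minimax:
  fixes f :: "'b::real_vector \<Rightarrow> 'a::{real_inner, complete_space} \<Rightarrow> real"
  assumes "convex E" and K: "closed K" "convex K" "bounded K" "K \<noteq> {}"
    and cont: "\<And>e. e \<in> E \<Longrightarrow> continuous_on UNIV (f e)"
    and conv: "\<And>e. e \<in> E \<Longrightarrow> convex_on UNIV (f e)"
    and conc: "\<And>x. concave_on E (\<lambda>e. f e x)"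
    and lt: "\<And>e c. e \<in> E \<Longrightarrow> c \<in> C \<Longrightarrow> \<exists>x\<in>K. f e x < c"
  shows "\<exists>x\<in>K. \<forall>e\<in>E. \<forall>c\<in>C. f e x \<le> c"
proof -
  define L where "L e c = {x. f e x \<le> c}" for e c
  let ?\<C> = "insert K (case_prod L ` (E \<times> C))"
  have "\<Inter>?\<C> \<noteq> {}"
  proof (rule bounded_closed_convex_fip)
    fix S assume S: "S \<in> ?\<C>"
    show "closed S"
      using S K cont by (auto simp: L_def intro!: closed_Collect_le)
    show "convex S"
    proof (cases "S = K")
      case False
      then obtain e c where e: "e \<in> E" "S = L e c" using S by auto
      show ?thesis
        using convex_sublevel_set(1)[OF conv[OF e(1)]] by (simp add: e L_def)
    qed (use K in simp)
  next
    fix \<F> assume \<F>: "finite \<F>" "\<F> \<subseteq> ?\<C>" "K \<in> \<F>"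
    then have "finite (\<F> - {K})" "\<F> - {K} \<subseteq> case_prod L ` (E \<times> C)" by auto
    then obtain P where P: "finite P" "P \<subseteq> E \<times> C" "\<F> - {K} = case_prod L ` P"
      using finite_subset_image by metis
    show "\<Inter>\<F> \<noteq> {}"
    proof (cases "P = {}")
      case True
      then have "\<F> = {K}" using P \<F> by auto
      then show ?thesis using K by simp
    next
      case False
      \<comment> \<open>The smallest of the finitely many levels serves for all of them.\<close>
      define c where "c = Min (snd ` P)"
      have "c \<in> snd ` P" using P False by (simp add: c_def)
      then have "c \<in> C" using P by auto
      have "\<exists>x\<in>K. \<forall>e\<in>fst ` P. f e x < c"
      proof (rule finite_minimax[OF _ _ \<open>convex E\<close> K(2,4) _ conc])
        show "convex_on K (f e)" if "e \<in> E" for e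
          using conv[OF that] subset_UNIV K(2) by (rule convex_on_subset)
      qed (use P lt \<open>c \<in> C\<close> in auto)
      then obtain x where x: "x \<in> K" "\<And>e. e \<in> fst ` P \<Longrightarrow> f e x < c" by blast
      have "x \<in> L e d" if "(e, d) \<in> P" for e d
      proof -
        have "c \<le> d" using P(1) that by (force simp: c_def intro: Min_le)
        then show ?thesis using x(2)[of e] that by (force simp: L_def)
      qed
      then have "x \<in> \<Inter>(insert K (case_prod L ` P))" using x(1) by auto
      moreover have "insert K (case_prod L ` P) = \<F>" using P(3) \<F>(3) by blast
      ultimately show ?thesis by blast
    qed
  qed (use K in auto)
  then obtain x where "x \<in> K" "\<And>e c. e \<in> E \<Longrightarrow> c \<in> C \<Longrightarrow> x \<in> L e c" by auto
  then show ?thesis unfolding L_def by blast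
qed

section \<open>Weak boundedness and norm boundedness\<close>

text \<open>Uniform boundedness: the closed sets \<open>E n\<close> cover the space, so by Baire one
  of them contains a ball, on which all functionals from \<open>X\<close> share the upper bound
  \<open>n\<close>.\<close>

lemma weakly_bounded_imp_bounded:
  fixes X :: "'a::{real_inner, complete_space} set"
  assumes "weakly_bounded X"
  shows "bounded X"
proof -
  define E where "E n = {y. \<forall>x\<in>X. x \<bullet> y \<le> real n}" for n
  have ub: "\<exists>n. \<forall>x\<in>X. x \<bullet> y \<le> real n" for y
  proof -
    have "(SUP x\<in>X. ereal (x \<bullet> y)) < \<infinity>" using assms by (simp add: weakly_bounded_def)
    then obtain n where "(SUP x\<in>X. ereal (x \<bullet> y)) < ereal (real n)"
      using less_PInf_Ex_of_nat by auto
    then have "x \<bullet> y \<le> real n" if "x \<in> X" for x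
      using SUP_upper[OF that, of "\<lambda>x. ereal (x \<bullet> y)"] by (metis ereal_less_eq(3) less_imp_le order_trans)
    then show ?thesis by blast
  qed
  have "\<exists>n. interior (E n) \<noteq> {}"
  proof (rule ccontr)
    assume neg: "\<not> ?thesis"
    have "closed (E n)" for n
    proof -
      have "E n = (\<Inter>x\<in>X. {y. x \<bullet> y \<le> real n})" by (auto simp: E_def)
      then show ?thesis by (auto intro!: closed_halfspace_le)
    qed
    then have "euclidean interior_of (\<Union>(range E)) = {}"
      using neg completely_metrizable_space_euclidean
      by (intro Baire_category_alt) auto
    moreover have "\<Union>(range E) = UNIV"
      using ub by (auto simp: E_def)
    ultimately show False by simp
  qed
  then obtain n y0 r where r: "r > 0" "ball y0 r \<subseteq> E n"
    by (metis ex_in_conv mem_interior)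
  obtain m where m: "\<And>x. x \<in> X \<Longrightarrow> x \<bullet> (- y0) \<le> real m" using ub by blast
  have "norm x \<le> 2 * (real n + real m) / r" if x: "x \<in> X" for x
  proof (cases "x = 0")
    case False
    \<comment> \<open>\<open>z\<close> has norm \<open>r / 2\<close> and the direction of
      \<open>x\<close>, so pairing \<open>x\<close> with \<open>y0 + z\<close> isolates
      \<open>norm x\<close>; the bound \<open>m\<close> at \<open>- y0\<close> absorbs the
      center.\<close>
    define z where "z = (r / (2 * norm x)) *\<^sub>R x"
    have "norm z < r" using r False by (simp add: z_def)
    then have "y0 + z \<in> E n" using r(2) by (auto simp: dist_norm)
    then have "x \<bullet> y0 + x \<bullet> z \<le> real n" using x by (simp add: E_def inner_add_right)
    moreover have "x \<bullet> z = r / 2 * norm x"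
      using False by (simp add: z_def dot_square_norm power2_eq_square)
    ultimately have "r / 2 * norm x \<le> real n + real m" using m[OF x] by simp
    then show ?thesis using r by (simp add: field_simps)
  qed (use r in simp)
  then show ?thesis by (auto simp: bounded_iff)
qed

lemma bounded_imp_weakly_bounded:
  assumes "bounded X"
  shows "weakly_bounded X"
  unfolding weakly_bounded_def
proof
  fix y
  obtain B where B: "\<And>x. x \<in> X \<Longrightarrow> norm x \<le> B" using assms by (auto simp: bounded_iff)
  have "(SUP x\<in>X. ereal (x \<bullet> y)) \<le> ereal (B * norm y)"
  proof (rule SUP_least)
    fix x assume "x \<in> X"
    have "x \<bullet> y \<le> norm x * norm y" by (rule norm_cauchy_schwarz)
    also have "\<dots> \<le> B * norm y" using B[OF \<open>x \<in> X\<close>] by (rule mult_right_mono) simp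
    finally show "ereal (x \<bullet> y) \<le> ereal (B * norm y)" by simp
  qed
  then show "(SUP x\<in>X. ereal (x \<bullet> y)) < \<infinity>" by (rule le_less_trans) simp
qed

section \<open>Weak and strong duality for conjugates\<close>

lemma lower_add_mono: "a \<le> a' \<Longrightarrow> b \<le> b' \<Longrightarrow> a +\<^sub>l b \<le> a' +\<^sub>l b'"
  by (auto simp: lower_add_def add_mono)

lemma lower_add_commute: "a +\<^sub>l b = b +\<^sub>l a"
  by (simp add: lower_add_def add.commute)

text \<open>This is the Fenchel-Young inequality, rearranged with care for infinite values.\<close>

lemma biconjugate_le: "biconjugate f x \<le> f x"
  unfolding biconjugate_def
proof (rule SUP_least)
  fix y
  have "ereal (x \<bullet> y) +\<^sub>l (- f x) \<le> conjugate f y"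
    unfolding conjugate_def by (rule SUP_upper) simp
  then show "ereal (x \<bullet> y) +\<^sub>l (- conjugate f y) \<le> f x"
    by (cases "f x"; cases "conjugate f y") (auto simp: lower_add_def)
qed

text \<open>A closed half-space containing \<open>X\<close> also contains its closed convex
  hull.\<close>

lemma inner_le_support_fun_closed_convex_hull:
  assumes "X \<noteq> {}" and "x \<in> closed_convex_hull X"
  shows "ereal (x \<bullet> y) \<le> support_fun X y"
proof (cases "support_fun X y")
  case (real s)
  have "closed_convex_hull X \<subseteq> {x. y \<bullet> x \<le> s}"
  proof (intro closure_minimal hull_minimal closed_halfspace_le convex_halfspace_le subsetI)
    fix x assume "x \<in> X"
    then have "ereal (x \<bullet> y) \<le> ereal s"
      unfolding real[symmetric] support_fun_def by (rule SUP_upper)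
    then show "x \<in> {x. y \<bullet> x \<le> s}" by (simp add: inner_commute)
  qed
  then show ?thesis using assms(2) by (auto simp: real inner_commute)
next
  case MInf
  obtain x' where "x' \<in> X" using assms(1) by blast
  then have "ereal (x' \<bullet> y) \<le> support_fun X y" unfolding support_fun_def by (rule SUP_upper)
  then show ?thesis using MInf by simp
qed simp

lemma support_fun_uminus: "support_fun (uminus ` X) y = support_fun X (- y)"
  by (simp add: support_fun_def image_image)

text \<open>The negated support term is an infimum of \<open>x \<bullet> y\<close> over
  \<open>X\<close>, hence a lower bound for \<open>x \<bullet> y\<close> on the hull. The function
  \<open>F\<close> will be a conjugate, which makes \<open>conjugate F\<close> a
  biconjugate.\<close>

theorem weak_duality:
  assumes "X \<noteq> {}" and "x \<in> closed_convex_hull X"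
  shows "(- F y) +\<^sub>l (- support_fun (uminus ` X) y) \<le> conjugate F x"
proof -
  have "- support_fun (uminus ` X) y \<le> ereal (y \<bullet> x)"
    using inner_le_support_fun_closed_convex_hull[OF assms, of "- y"]
    using ereal_uminus_le_reorder[of "support_fun X (- y)" "ereal (x \<bullet> y)"]
    by (simp add: support_fun_uminus inner_commute)
  then have "(- F y) +\<^sub>l (- support_fun (uminus ` X) y) \<le> ereal (y \<bullet> x) +\<^sub>l (- F y)"
    by (subst lower_add_commute) (rule lower_add_mono, auto)
  also have "\<dots> \<le> conjugate F x"
    unfolding conjugate_def by (rule SUP_upper) simp
  finally show ?thesis .
qed

text \<open>\<open>conjugate F\<close> is the supremum of \<open>x \<bullet> y - r\<close> over the
  epigraph of \<open>F\<close>. Indexing by the epigraph keeps these functions real-valued and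
  affine in the index, so convexity of \<open>F\<close> enters as convexity of the index
  set.\<close>

theorem strong_duality:
  fixes X :: "'a::{real_inner, complete_space} set"
  assumes "X \<noteq> {}" "bounded X" "convex_fun F"
  shows "\<exists>x\<in>closed_convex_hull X.
    conjugate F x \<le> (SUP y. (- F y) +\<^sub>l (- support_fun (uminus ` X) y))"
proof -
  define v where "v = (SUP y. (- F y) +\<^sub>l (- support_fun (uminus ` X) y))"
  define K where "K = closed_convex_hull X"
  define E where "E = {(y, r::real). F y \<le> ereal r}"
  have XK: "X \<subseteq> K"
    unfolding K_def using hull_subset closure_subset by (rule order_trans)
  \<comment> \<open>If \<open>x \<bullet> y - r\<close> were at least \<open>c\<close> on all of
    \<open>K\<close>, the support term at \<open>y\<close> would contribute at least
    \<open>c + r\<close> and \<open>- F y\<close> at least \<open>- r\<close>, forcing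
    \<open>v\<close> to be at least \<open>c\<close>.\<close>
  have approx: "\<exists>x\<in>K. x \<bullet> y - r < c" if Fy: "F y \<le> ereal r" and c: "v < ereal c" for y r c
  proof (rule ccontr)
    assume neg: "\<not> ?thesis"
    have "support_fun (uminus ` X) y \<le> ereal (- (c + r))"
      unfolding support_fun_def
      using neg XK by (intro SUP_least) (auto simp: not_less subset_eq algebra_simps)
    then have "ereal (c + r) \<le> - support_fun (uminus ` X) y"
      using ereal_minus_le_minus[of "ereal (- (c + r))" "support_fun (uminus ` X) y"]
      by (simp add: add.commute)
    moreover have "ereal (- r) \<le> - F y"
      using Fy ereal_minus_le_minus[of "ereal r" "F y"] by simp
    ultimately have "ereal (- r) +\<^sub>l ereal (c + r) \<le> (- F y) +\<^sub>l (- support_fun (uminus ` X) y)"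
      by (intro lower_add_mono)
    also have "\<dots> \<le> v"
      unfolding v_def by (rule SUP_upper) simp
    finally show False using c by (simp add: lower_add_def)
  qed
  \<comment> \<open>Taking all real levels above \<open>v\<close> also covers infinite values of
    \<open>v\<close>.\<close>
  have "\<exists>x\<in>K. \<forall>e\<in>E. \<forall>c\<in>{c. v < ereal c}. x \<bullet> fst e - snd e \<le> c"
  proof (rule bounded_minimax)
    show "convex E" using assms(3) by (simp add: E_def convex_fun_def)
    then show "concave_on E (\<lambda>e. x \<bullet> fst e - snd e)" for x
      by (simp add: concave_on_iff algebra_simps inner_simps)
    show "closed K" "convex K" "bounded K" "K \<noteq> {}"
      using assms XK by (auto simp: K_def convex_closure bounded_closure bounded_convex_hull)
    show "continuous_on UNIV (\<lambda>x. x \<bullet> fst e - snd e)" for e :: "'a \<times> real"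
      by (intro continuous_intros)
    show "convex_on UNIV (\<lambda>x. x \<bullet> fst e - snd e)" for e :: "'a \<times> real"
      by (intro convex_onI) (auto simp: algebra_simps inner_simps)
  qed (use approx in \<open>auto simp: E_def\<close>)
  then obtain x where "x \<in> K"
    and x: "\<And>y r c. F y \<le> ereal r \<Longrightarrow> v < ereal c \<Longrightarrow> x \<bullet> y - r \<le> c"
    by (force simp: E_def)
  have "ereal (y \<bullet> x) +\<^sub>l (- F y) \<le> v" for y
  proof (rule dense_ge)
    fix c assume c: "v < c"
    then obtain c' where c': "v < ereal c'" "ereal c' < c"
      using ereal_dense2 by blast
    have "ereal (y \<bullet> x) +\<^sub>l (- F y) \<le> ereal c'"
    proof (cases "F y")
      case (real r)
      then show ?thesis using x[of y r c'] c'(1) by (simp add: lower_add_def inner_commute)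
    next
      case MInf
      \<comment> \<open>Over a point where \<open>F\<close> is \<open>-\<infinity>\<close> the
        epigraph contains every \<open>r\<close>; this choice yields the contradiction
        \<open>c' + 1 \<le> c'\<close>.\<close>
      then show ?thesis using x[of y "x \<bullet> y - c' - 1" c'] c'(1) by simp
    qed (simp add: lower_add_def)
    then show "ereal (y \<bullet> x) +\<^sub>l (- F y) \<le> c" using c'(2) by simp
  qed
  then have "conjugate F x \<le> v" unfolding conjugate_def by (rule SUP_least)
  then show ?thesis using \<open>x \<in> K\<close> by (auto simp: K_def v_def)
qed

section \<open>Application to the infimal postcomposition\<close>

text \<open>Both dualities are applied to the conjugate of the postcomposition, which is convex. The
  feasible set is the hull of the image of \<open>\<theta>\<close>, not of its negative, since the
  dual support term is an infimum over that image.\<close>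

theorem corollary5:
  fixes h :: "'w \<Rightarrow> ereal"
    and W :: "'w set"
    and \<theta> :: "'w \<Rightarrow> 'a::{real_inner, complete_space}"
  assumes "W \<noteq> {}"
    and "weakly_bounded (uminus ` \<theta> ` W)"
    and "proper_fun (conjugate (inf_postcomp W \<theta> h))"
  shows "(SUP y. (- conjugate (inf_postcomp W \<theta> h) y) +\<^sub>l (- support_fun (uminus ` \<theta> ` W) y))
           = (INF x\<in>closed_convex_hull (\<theta> ` W). biconjugate (inf_postcomp W \<theta> h) x)
       \<and> (\<exists>x\<in>closed_convex_hull (\<theta> ` W). biconjugate (inf_postcomp W \<theta> h) x
             = (INF x\<in>closed_convex_hull (\<theta> ` W). biconjugate (inf_postcomp W \<theta> h) x))
       \<and> (INF x\<in>closed_convex_hull (\<theta> ` W). biconjugate (inf_postcomp W \<theta> h) x)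
           \<le> (INF w\<in>W. h w)
       \<and> lower_semicontinuous (biconjugate (inf_postcomp W \<theta> h))
       \<and> convex_fun (biconjugate (inf_postcomp W \<theta> h))
       \<and> weakly_bounded (closed_convex_hull (\<theta> ` W))
       \<and> closed (closed_convex_hull (\<theta> ` W))
       \<and> convex (closed_convex_hull (\<theta> ` W))"
proof -
  let ?f = "inf_postcomp W \<theta> h"
  let ?K = "closed_convex_hull (\<theta> ` W)"
  define v where
    "v = (SUP y. (- conjugate ?f y) +\<^sub>l (- support_fun (uminus ` \<theta> ` W) y))"
  have ne: "\<theta> ` W \<noteq> {}" using assms(1) by simp
  have bdd: "bounded (\<theta> ` W)"
    using bounded_uminus weakly_bounded_imp_bounded[OF assms(2)] by blast
  have le: "v \<le> biconjugate ?f x" if "x \<in> ?K" for x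
    unfolding v_def biconjugate_eq_conjugate
    using weak_duality[OF ne that] by (rule SUP_least)
  obtain x0 where x0: "x0 \<in> ?K" "biconjugate ?f x0 \<le> v"
    unfolding v_def biconjugate_eq_conjugate
    using strong_duality[OF ne bdd convex_fun_conjugate] by blast
  have v_eq: "v = (INF x\<in>?K. biconjugate ?f x)"
    using x0 by (intro antisym INF_greatest le) (auto intro: INF_lower2)
  \<comment> \<open>Each \<open>w\<close> provides the feasible point \<open>\<theta> w\<close>,
    where the biconjugate lies below the postcomposition and hence below \<open>h w\<close>.\<close>
  have "(INF x\<in>?K. biconjugate ?f x) \<le> h w" if "w \<in> W" for w
  proof (rule INF_lower2)
    show "\<theta> w \<in> ?K"
      using closure_subset by (rule subsetD) (simp add: hull_inc that)
    have "?f (\<theta> w) \<le> h w"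
      unfolding inf_postcomp_def using that by (intro INF_lower) simp
    then show "biconjugate ?f (\<theta> w) \<le> h w"
      using biconjugate_le by (rule order_trans[rotated])
  qed
  then have "(INF x\<in>?K. biconjugate ?f x) \<le> (INF w\<in>W. h w)"
    by (rule INF_greatest)
  moreover have "weakly_bounded ?K"
    by (intro bounded_imp_weakly_bounded bounded_closure bounded_convex_hull bdd)
  moreover have "biconjugate ?f x0 = (INF x\<in>?K. biconjugate ?f x)"
    using le[OF x0(1)] x0(2) v_eq by simp
  ultimately show ?thesis
    using v_eq x0(1) convex_fun_conjugate[of "conjugate ?f"]
      lower_semicontinuous_conjugate[of "conjugate ?f"]
    by (auto simp: v_def biconjugate_eq_conjugate convex_closure)
qed

end
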